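(* For every finite digraph $\Gamma$ and every integer $s\ge 1$, $$ c_{s,s}(\Gamma)=c\left(\Gamma^{[s]}\right). $$
   Context: The $(r,s)$ game on a finite digraph $\Gamma$: the cops choose their initial vertices first, then the robber chooses its initial vertex. Thereafter players alternate, the cops moving first in each round. On the cops' move each cop (of speed $r$) may remain where it is or move along a directed path of length at most $r$. On the robber's move, the robber (of speed $s$) may remain where it is or move along a directed path of length at most $s$ no vertex of which (including the terminal vertex) is occupied by a cop. A directed path is a vertex sequence without repetition whose consecutive vertices are joined by arcs in the forward direction; its length is its number of arcs, and length zero is allowed. Capture occurs as soon as a cop and the robber occupy the same vertex. $c_{r,s}(\Gamma)$ is the least number of speed-$r$ cops that guarantee capture of a speed-$s$ robber. $c(\Gamma)$ is the ordinary cop number, i.e. the minimum number of cops guaranteeing capture in the game where cops and robber all have speed one. $\Gamma^{[s]}$ is the digraph on $V(\Gamma)$ with an arc $x\to y$ whenever $x\ne y$ and the directed distance from $x$ to $y$ in $\Gamma$ is at most $s$. *)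

theory Defs
  imports "Graph_Theory.Shortest_Path"
begin

text \<open>
  Digraphs are those of the library: loops and parallel arcs are allowed. The positions of
  \<open>k\<close> cops are a list of \<open>k\<close> vertices (several cops may share a vertex).
\<close>

definition cops_move :: "('a, 'b) pre_digraph \<Rightarrow> nat \<Rightarrow> 'a list \<Rightarrow> 'a list \<Rightarrow> bool" where
  "cops_move G r C C' \<longleftrightarrow>
     list_all2 (\<lambda>u v. \<exists>p. pre_digraph.apath G u p v \<and> length p \<le> r) C C'"

definition robber_move :: "('a, 'b) pre_digraph \<Rightarrow> nat \<Rightarrow> 'a list \<Rightarrow> 'a \<Rightarrow> 'a \<Rightarrow> bool" where
  "robber_move G s C x y \<longleftrightarrow>
     y = x \<or>
     (\<exists>p. pre_digraph.apath G x p y \<and> length p \<le> s \<and>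
          set (pre_digraph.awalk_verts G x p) \<inter> set C = {})"

text \<open>
  A strategy \<open>\<sigma>\<close> maps the list of robber positions seen so far, oldest first, to the cops'
  positions: \<open>\<sigma> []\<close> is the initial placement, and \<open>\<sigma> [R 0, \<dots>, R n]\<close> are the positions after
  the cops' move answering \<open>R n\<close>. The cops' own past positions need not be recorded, since
  \<open>\<sigma>\<close> determines them from the robber's. Legality is required for all histories; since cops may
  always stay put, a strategy defined on the reachable histories only can be extended to all.
\<close>

definition cops_strategy ::
  "('a, 'b) pre_digraph \<Rightarrow> nat \<Rightarrow> nat \<Rightarrow> ('a list \<Rightarrow> 'a list) \<Rightarrow> bool" where
  "cops_strategy G r k \<sigma> \<longleftrightarrow>
     length (\<sigma> []) = k \<and> set (\<sigma> []) \<subseteq> verts G \<and>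
     (\<forall>h \<in> lists (verts G). \<forall>x \<in> verts G. cops_move G r (\<sigma> h) (\<sigma> (h @ [x])))"

definition cops_at :: "('a list \<Rightarrow> 'a list) \<Rightarrow> (nat \<Rightarrow> 'a) \<Rightarrow> nat \<Rightarrow> 'a list" where
  "cops_at \<sigma> R n = \<sigma> (map R [0..<n])"

text \<open>
  Plays are formally continued after a capture; as the robber may always remain where it is,
  every play that ends in a capture has such a continuation.
\<close>

definition robber_play ::
  "('a, 'b) pre_digraph \<Rightarrow> nat \<Rightarrow> ('a list \<Rightarrow> 'a list) \<Rightarrow> (nat \<Rightarrow> 'a) \<Rightarrow> bool" where
  "robber_play G s \<sigma> R \<longleftrightarrow>
     R 0 \<in> verts G \<and> (\<forall>n. robber_move G s (cops_at \<sigma> R (Suc n)) (R n) (R (Suc n)))"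

text \<open>
  The robber at \<open>R n\<close> is caught either on arriving there (cops at \<open>cops_at \<sigma> R n\<close>) or by the
  cops' next move.
\<close>

definition captures :: "('a list \<Rightarrow> 'a list) \<Rightarrow> (nat \<Rightarrow> 'a) \<Rightarrow> bool" where
  "captures \<sigma> R \<longleftrightarrow>
     (\<exists>n. R n \<in> set (cops_at \<sigma> R n) \<or> R n \<in> set (cops_at \<sigma> R (Suc n)))"

definition cops_win :: "('a, 'b) pre_digraph \<Rightarrow> nat \<Rightarrow> nat \<Rightarrow> nat \<Rightarrow> bool" where
  "cops_win G r s k \<longleftrightarrow>
     (\<exists>\<sigma>. cops_strategy G r k \<sigma> \<and> (\<forall>R. robber_play G s \<sigma> R \<longrightarrow> captures \<sigma> R))"

definition speed_cop_number :: "('a, 'b) pre_digraph \<Rightarrow> nat \<Rightarrow> nat \<Rightarrow> nat" where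
  "speed_cop_number G r s = (LEAST k. cops_win G r s k)"

definition cop_number :: "('a, 'b) pre_digraph \<Rightarrow> nat" where
  "cop_number G = speed_cop_number G 1 1"

text \<open>
  \<open>\<mu>\<close> with unit weights is the directed distance (infinite for unreachable vertices).
\<close>

definition dist_power :: "('a, 'b) pre_digraph \<Rightarrow> nat \<Rightarrow> ('a, 'a \<times> 'a) pre_digraph" where
  "dist_power G s =
     \<lparr> verts = verts G,
       arcs = {(x, y). x \<in> verts G \<and> y \<in> verts G \<and> x \<noteq> y \<and>
                       wf_digraph.\<mu> G (\<lambda>_. 1) x y \<le> ereal (real s)},
       tail = fst, head = snd \<rparr>"

text \<open>The minimum in the cop number is attained: a cop on every vertex wins at once.\<close>

lemma cops_win_card_verts:
  assumes "fin_digraph G"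
  shows "cops_win G r s (card (verts G))"
proof -
  interpret fin_digraph G by fact
  obtain xs where xs: "set xs = verts G" "distinct xs"
    using finite_distinct_list[OF finite_verts] by blast
  have "cops_move G r xs xs"
    unfolding cops_move_def list_all2_same
  proof
    fix x assume "x \<in> set xs"
    then have "apath x [] x" using xs by (simp add: apath_Nil_iff)
    then show "\<exists>p. apath x p x \<and> length p \<le> r" by fastforce
  qed
  then have "cops_strategy G r (card (verts G)) (\<lambda>_. xs)"
    using xs distinct_card[of xs] by (simp add: cops_strategy_def)
  moreover have "captures (\<lambda>_. xs) R" if "robber_play G s (\<lambda>_. xs) R" for R
    using that xs unfolding captures_def robber_play_def cops_at_def by auto
  ultimately show ?thesis unfolding cops_win_def by blast
qed

lemma (in wf_digraph) unit_dist_le_iff: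
  "\<mu> (\<lambda>_. 1) x y \<le> ereal (real s) \<longleftrightarrow> (\<exists>p. awalk x p y \<and> length p \<le> s)"
proof
  have cost: "awalk_cost (\<lambda>_. 1) p = real (length p)" for p :: "'b list"
    by (induct p) auto
  {
    assume "\<exists>p. awalk x p y \<and> length p \<le> s"
    then obtain p where p: "awalk x p y" "length p \<le> s" by blast
    have "\<mu> (\<lambda>_. 1) x y \<le> ereal (real (length p))"
      using min_cost_le_walk_cost[OF p(1), of "\<lambda>_. 1"] by (simp add: cost)
    also have "\<dots> \<le> ereal (real s)" using p(2) by simp
    finally show "\<mu> (\<lambda>_. 1) x y \<le> ereal (real s)" .
  }
  {
    assume "\<mu> (\<lambda>_. 1) x y \<le> ereal (real s)"
    then have "\<mu> (\<lambda>_. 1) x y < ereal (real s + 1)"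
      by (rule le_less_trans) simp
    then obtain p where "awalk x p y" "real (length p) < real s + 1"
      unfolding \<mu>_def by (auto simp: INF_less_iff cost)
    then show "\<exists>p. awalk x p y \<and> length p \<le> s"
      by (intro exI[of _ p]) auto
  }
qed

end

theory Submission
  imports Defs
begin

text \<open>
  The cops have the same moves in both games, and every robber move in \<open>G\<close> is one in
  \<open>dist_power G s\<close>, so a winning strategy for the latter game wins the former. Conversely, let the
  cops follow a strategy that wins in \<open>G\<close> until the robber first moves from \<open>x\<close> to \<open>y\<close> in a way
  that is legal in \<open>dist_power G s\<close> only. Then a walk of length at most \<open>s\<close> from \<open>x\<close> to \<open>y\<close> meets
  a cop, who can follow the rest of that walk and catch the robber at \<open>y\<close>.
\<close>

text \<open>Each step of \<open>awalk_to_apath\<close> cuts a cycle \<open>r\<close> out of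
  \<open>q @ r @ s\<close>, which can only shorten the walk.\<close>

lemma (in wf_digraph) length_awalk_to_apath_le:
  assumes "awalk u p v"
  shows "length (awalk_to_apath p) \<le> length p"
  using assms
proof (induct rule: awalk_to_apath_induct)
  case (path p)
  then have "awalk_to_apath p = p" by (auto simp: awalk_to_apath.simps)
  then show ?case by simp
next
  case (decomp p q r s)
  have "is_awalk_cyc_decomp p (q, r, s)"
    using awalk_cyc_decomp_has_prop[OF decomp(1,3)] decomp(2) by simp
  then have "length (q @ s) \<le> length p" by auto
  then show ?case using step_awalk_to_apath[OF decomp(1-3)] decomp(4) by simp
qed

text \<open>Distances are stated with walks, moves with paths; deleting cycles makes the two
  interchangeable under a length bound.\<close>

lemma (in wf_digraph) short_apath_iff_short_awalk:
  "(\<exists>p. apath u p v \<and> length p \<le> s) \<longleftrightarrow> (\<exists>p. awalk u p v \<and> length p \<le> s)"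
  by (meson apath_awalk_to_apath apath_def length_awalk_to_apath_le order_trans)

lemma (in wf_digraph) apath_length_le_1_cases:
  assumes "apath u p v" "length p \<le> 1"
  obtains "p = []" "u = v" "u \<in> verts G"
  | e where "p = [e]" "e \<in> arcs G" "tail G e = u" "head G e = v" "u \<noteq> v"
  using assms by (cases p) (auto simp: apath_simps)

section \<open>Moves in a digraph and in its distance power\<close>

lemma verts_dist_power [simp]: "verts (dist_power G s) = verts G"
  by (simp add: dist_power_def)

context wf_digraph
begin

lemma dist_power_arcs_iff:
  "e \<in> arcs (dist_power G s) \<longleftrightarrow>
     fst e \<noteq> snd e \<and> (\<exists>p. awalk (fst e) p (snd e) \<and> length p \<le> s)"
  unfolding dist_power_def by (auto simp: unit_dist_le_iff split: prod.splits)

lemma wf_digraph_dist_power: "wf_digraph (dist_power G s)"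
  by unfold_locales (auto simp: dist_power_def)

lemma dist_power_arc_apath:
  assumes "x \<noteq> y" "awalk x p y" "length p \<le> s"
  shows "pre_digraph.apath (dist_power G s) x [(x, y)] y"
    and "pre_digraph.awalk_verts (dist_power G s) x [(x, y)] = [x, y]"
proof -
  interpret H: wf_digraph "dist_power G s" by (rule wf_digraph_dist_power)
  have "(x, y) \<in> arcs (dist_power G s)" using assms by (auto simp: dist_power_arcs_iff)
  moreover have "tail (dist_power G s) (x, y) = x" "head (dist_power G s) (x, y) = y"
    by (simp_all add: dist_power_def)
  moreover have "y \<in> verts G" using assms by auto
  ultimately show "H.apath x [(x, y)] y" "H.awalk_verts x [(x, y)] = [x, y]"
    using assms by (auto simp: H.apath_simps)
qed

text \<open>An arc of the power stands for a walk of length at most \<open>s\<close>, hence for a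
  path. There are no loops, so staying put is the empty path on both sides. Cops may pass occupied
  vertices, so this makes the cop moves of the two games coincide.\<close>

lemma short_apath_dist_power_iff:
  "(\<exists>p. pre_digraph.apath (dist_power G s) u p v \<and> length p \<le> 1) \<longleftrightarrow>
   (\<exists>p. apath u p v \<and> length p \<le> s)" (is "?L \<longleftrightarrow> ?R")
proof
  interpret H: wf_digraph "dist_power G s" by (rule wf_digraph_dist_power)
  show ?R if ?L
  proof -
    from that obtain p where p: "H.apath u p v" "length p \<le> 1" by blast
    then show ?R
    proof (cases rule: H.apath_length_le_1_cases)
      case 1
      then have "apath u [] v \<and> length ([] :: 'b list) \<le> s" by (simp add: apath_Nil_iff)
      then show ?thesis by blast
    next
      case (2 e)
      then have "fst e = u" "snd e = v" by (simp_all add: dist_power_def)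
      then show ?thesis
        using 2 unfolding short_apath_iff_short_awalk dist_power_arcs_iff by blast
    qed
  qed
  show ?L if short: ?R
  proof (cases "u = v")
    case True
    then have "u \<in> verts G" using short by (auto simp: apath_def)
    then have "H.apath u [] v" using True by (simp add: H.apath_Nil_iff)
    then show ?thesis by (intro exI[of _ "[]"]) simp
  next
    case False
    then obtain p where "awalk u p v" "length p \<le> s" using short by (auto simp: apath_def)
    from dist_power_arc_apath(1)[OF False this] show ?thesis
      by (intro exI[of _ "[(u, v)]"]) simp
  qed
qed

lemma cops_move_dist_power: "cops_move (dist_power G s) 1 = cops_move G s"
  unfolding cops_move_def short_apath_dist_power_iff ..

lemma cops_strategy_dist_power: "cops_strategy (dist_power G s) 1 = cops_strategy G s"
  unfolding cops_strategy_def cops_move_dist_power verts_dist_power ..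

text \<open>The arc from \<open>x\<close> to \<open>y\<close> visits only these two vertices, and
  both lie on the cop-free path in \<open>G\<close>.\<close>

lemma robber_move_dist_powerI:
  assumes "robber_move G s C x y"
  shows "robber_move (dist_power G s) 1 C x y"
proof (cases "y = x")
  case False
  then obtain p where p: "apath x p y" "length p \<le> s" "set (awalk_verts x p) \<inter> set C = {}"
    using assms unfolding robber_move_def by blast
  then have w: "awalk x p y" by (simp add: apath_def)
  then have "x \<in> set (awalk_verts x p)" "y \<in> set (awalk_verts x p)"
    using hd_in_awalk_verts(1) by auto
  then have "set [x, y] \<inter> set C = {}" using p(3) by auto
  with dist_power_arc_apath[OF False[symmetric] w p(2)] show ?thesis
    unfolding robber_move_def
    by (intro disjI2 exI[of _ "[(x, y)]"]) simp
qed (simp add: robber_move_def)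

lemma robber_move_dist_powerD:
  assumes "robber_move (dist_power G s) 1 C x y" "y \<noteq> x"
  obtains p where "apath x p y" "length p \<le> s"
  using assms short_apath_dist_power_iff[of s x y] unfolding robber_move_def by blast

section \<open>Reaching a vertex in one cops' move\<close>

lemma cops_move_refl: "set C \<subseteq> verts G \<Longrightarrow> cops_move G s C C"
  unfolding cops_move_def list_all2_same
  by (metis apath_Nil_iff le0 list.size(3) subsetD)

lemma cops_move_verts:
  assumes "cops_move G s C C'"
  shows "set C' \<subseteq> verts G"
  using assms awalk_last_in_verts unfolding cops_move_def list_all2_conv_all_nth
  by (fastforce simp: in_set_conv_nth apath_def)

text \<open>One cop on \<open>z\<close> goes to \<open>y\<close> and all others stay put; staying is
  the empty path, which requires the cop to be on a vertex of \<open>G\<close>.\<close>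

lemma cops_move_reaches:
  assumes "set C \<subseteq> verts G" "z \<in> set C" "awalk z q y" "length q \<le> s"
  obtains C' where "cops_move G s C C'" "y \<in> set C'"
proof -
  obtain i where i: "i < length C" "C ! i = z" using assms(2) by (auto simp: in_set_conv_nth)
  have "\<exists>p. apath (C ! j) p (C[i := y] ! j) \<and> length p \<le> s" if "j < length C" for j
  proof (cases "j = i")
    case True
    then show ?thesis using assms(3,4) i short_apath_iff_short_awalk by auto
  next
    case False
    then show ?thesis
      using cops_move_refl[OF assms(1), of s] that
      unfolding cops_move_def list_all2_conv_all_nth by simp
  qed
  then have "cops_move G s C (C[i := y])"
    unfolding cops_move_def list_all2_conv_all_nth by simp
  moreover have "y \<in> set (C[i := y])" using i(1) by (rule set_update_memI)
  ultimately show thesis by (rule that)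
qed

lemma cops_catch_after_jump:
  assumes "set C \<subseteq> verts G" "robber_move (dist_power G s) 1 C x y" "\<not> robber_move G s C x y"
  obtains C' where "cops_move G s C C'" "y \<in> set C'"
proof -
  have "y \<noteq> x" using assms(3) by (auto simp: robber_move_def)
  with assms(2) obtain p where p: "apath x p y" "length p \<le> s"
    by (rule robber_move_dist_powerD)
  \<comment> \<open>If \<open>p\<close> avoided all cops, it would witness the move as legal in
    \<open>G\<close>.\<close>
  then obtain z where z: "z \<in> set (awalk_verts x p)" "z \<in> set C"
    using assms(3) unfolding robber_move_def by blast
  obtain q r where "p = q @ r" and r: "awalk z r y"
    using awalk_decomp[OF _ z(1)] p(1) unfolding apath_def by blast
  then have "length r \<le> s" using p(2) by simp
  then show thesis by (rule cops_move_reaches[OF assms(1) z(2) r]) (rule that)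
qed

end

section \<open>The strategy that follows \<open>\<sigma>\<close> and then pounces\<close>

definition legal_history ::
  "('a, 'b) pre_digraph \<Rightarrow> nat \<Rightarrow> ('a list \<Rightarrow> 'a list) \<Rightarrow> 'a list \<Rightarrow> bool" where
  "legal_history G s \<sigma> h \<longleftrightarrow>
     (\<forall>i. Suc i < length h \<longrightarrow> robber_move G s (\<sigma> (take (Suc i) h)) (h ! i) (h ! Suc i))"

text \<open>Consequently, while the new strategy follows \<open>\<sigma>\<close>, its previous
  position was also that of \<open>\<sigma>\<close>, and once it has left \<open>\<sigma>\<close> it
  never returns.\<close>

lemma legal_history_butlast: "legal_history G s \<sigma> (h @ [x]) \<Longrightarrow> legal_history G s \<sigma> h"
  unfolding legal_history_def by (auto simp: nth_append dest: spec less_SucI)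

text \<open>The robber leaves \<open>R i\<close> after the cops have answered it, so they have then
  seen \<open>Suc i\<close> positions. A history of \<open>n\<close> positions tests only the moves
  between them.\<close>

lemma legal_history_map_upt:
  "legal_history G s \<sigma> (map R [0..<n]) \<longleftrightarrow>
     (\<forall>i. Suc i < n \<longrightarrow> robber_move G s (cops_at \<sigma> R (Suc i)) (R i) (R (Suc i)))"
  unfolding legal_history_def cops_at_def
  by (auto simp: take_map simp del: upt_Suc)

text \<open>The default \<open>C\<close> keeps this a legal move when \<open>x\<close> is out of
  reach, since strategies must be legal on all histories.\<close>

definition pounce :: "('a, 'b) pre_digraph \<Rightarrow> nat \<Rightarrow> 'a list \<Rightarrow> 'a \<Rightarrow> 'a list" where
  "pounce G s C x =
     (if \<exists>C'. cops_move G s C C' \<and> x \<in> set C' then SOME C'. cops_move G s C C' \<and> x \<in> set C'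
      else C)"

lemma pounce_catches:
  assumes "cops_move G s C C'" "x \<in> set C'"
  shows "x \<in> set (pounce G s C x)"
  unfolding pounce_def using someI[of "\<lambda>C'. cops_move G s C C' \<and> x \<in> set C'" C'] assms by auto

lemma (in wf_digraph) cops_move_pounce:
  assumes "set C \<subseteq> verts G"
  shows "cops_move G s C (pounce G s C x)"
  unfolding pounce_def using cops_move_refl[OF assms, of s]
    someI_ex[of "\<lambda>C'. cops_move G s C C' \<and> x \<in> set C'"] by auto

text \<open>Histories are extended at the end, so the recursion runs over the reversed history.\<close>

primrec follow_or_pounce_rev ::
  "('a, 'b) pre_digraph \<Rightarrow> nat \<Rightarrow> ('a list \<Rightarrow> 'a list) \<Rightarrow> 'a list \<Rightarrow> 'a list" where
  "follow_or_pounce_rev G s \<sigma> [] = \<sigma> []"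
| "follow_or_pounce_rev G s \<sigma> (x # h) =
     (if legal_history G s \<sigma> (rev h @ [x]) then \<sigma> (rev h @ [x])
      else pounce G s (follow_or_pounce_rev G s \<sigma> h) x)"

definition follow_or_pounce ::
  "('a, 'b) pre_digraph \<Rightarrow> nat \<Rightarrow> ('a list \<Rightarrow> 'a list) \<Rightarrow> 'a list \<Rightarrow> 'a list" where
  "follow_or_pounce G s \<sigma> h = follow_or_pounce_rev G s \<sigma> (rev h)"

lemma follow_or_pounce_Nil [simp]: "follow_or_pounce G s \<sigma> [] = \<sigma> []"
  by (simp add: follow_or_pounce_def)

lemma follow_or_pounce_snoc:
  "follow_or_pounce G s \<sigma> (h @ [x]) =
     (if legal_history G s \<sigma> (h @ [x]) then \<sigma> (h @ [x])
      else pounce G s (follow_or_pounce G s \<sigma> h) x)"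
  by (simp add: follow_or_pounce_def)

lemma follow_or_pounce_legal:
  "legal_history G s \<sigma> h \<Longrightarrow> follow_or_pounce G s \<sigma> h = \<sigma> h"
  by (cases h rule: rev_cases) (simp_all add: follow_or_pounce_snoc)

section \<open>Legality and success of the new strategy\<close>

context wf_digraph
begin

lemma cops_strategy_verts:
  assumes "cops_strategy G s k \<sigma>" "h \<in> lists (verts G)"
  shows "set (\<sigma> h) \<subseteq> verts G"
proof (cases h rule: rev_cases)
  case Nil
  then show ?thesis using assms(1) by (simp add: cops_strategy_def)
next
  case (snoc h' x)
  then have "cops_move G s (\<sigma> h') (\<sigma> h)"
    using assms unfolding cops_strategy_def by simp
  then show ?thesis by (rule cops_move_verts)
qed

lemma cops_strategy_follow_or_pounce:
  assumes "cops_strategy G s k \<sigma>"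
  shows "cops_strategy G s k (follow_or_pounce G s \<sigma>)" (is "cops_strategy G s k ?\<tau>")
proof -
  have step: "cops_move G s (?\<tau> h) (?\<tau> (h @ [x]))"
    if "h \<in> lists (verts G)" "x \<in> verts G" "set (?\<tau> h) \<subseteq> verts G" for h x
  proof (cases "legal_history G s \<sigma> (h @ [x])")
    case True
    then show ?thesis
      using assms that follow_or_pounce_legal[OF legal_history_butlast[OF True]]
      by (simp add: cops_strategy_def follow_or_pounce_snoc)
  next
    case False
    then show ?thesis using cops_move_pounce[OF that(3)] by (simp add: follow_or_pounce_snoc)
  qed
  \<comment> \<open>\<open>step\<close> presupposes that the cops stand on vertices and yields the
    same after the move, so induction along the history discharges that premise.\<close>
  have "set (?\<tau> h) \<subseteq> verts G" if "h \<in> lists (verts G)" for h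
    using that
  proof (induction h rule: rev_induct)
    case Nil
    then show ?case using assms by (simp add: cops_strategy_def)
  next
    case (snoc x h)
    then show ?case using cops_move_verts[OF step[of h x]] by simp
  qed
  with step assms show ?thesis by (simp add: cops_strategy_def)
qed

lemma robber_play_dist_power_verts:
  assumes "robber_play (dist_power G s) 1 \<sigma> R"
  shows "R n \<in> verts G"
proof (induction n)
  case 0
  then show ?case using assms by (simp add: robber_play_def)
next
  case (Suc n)
  have "robber_move (dist_power G s) 1 (cops_at \<sigma> R (Suc n)) (R n) (R (Suc n))"
    using assms by (simp add: robber_play_def)
  then obtain p where "R (Suc n) = R n \<or> apath (R n) p (R (Suc n))"
    by (metis robber_move_dist_powerD)
  then show ?case using Suc unfolding apath_def by auto
qed

lemma captures_follow_or_pounce: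
  assumes \<sigma>: "cops_strategy G s k \<sigma>"
    and win: "\<And>R. robber_play G s \<sigma> R \<Longrightarrow> captures \<sigma> R"
    and play: "robber_play (dist_power G s) 1 (follow_or_pounce G s \<sigma>) R"
  shows "captures (follow_or_pounce G s \<sigma>) R"
proof (cases "robber_play G s \<sigma> R")
  case True
  then have "cops_at (follow_or_pounce G s \<sigma>) R n = cops_at \<sigma> R n" for n
    unfolding cops_at_def
    by (intro follow_or_pounce_legal) (auto simp: legal_history_map_upt robber_play_def)
  then show ?thesis using win[OF True] by (simp add: captures_def)
next
  case False
  let ?\<tau> = "follow_or_pounce G s \<sigma>"
  let ?legal = "\<lambda>n. robber_move G s (cops_at \<sigma> R (Suc n)) (R n) (R (Suc n))"
  have verts: "R n \<in> verts G" for n using play by (rule robber_play_dist_power_verts)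
  \<comment> \<open>The robber's first move that is illegal in \<open>G\<close> against
    \<open>\<sigma>\<close> leads from \<open>R n\<close> to \<open>R (Suc n)\<close>.\<close>
  define n where "n = (LEAST n. \<not> ?legal n)"
  have "\<exists>n. \<not> ?legal n" using False verts by (auto simp: robber_play_def)
  then have jump: "\<not> ?legal n" unfolding n_def by (rule LeastI_ex)
  have "?legal i" if "i < n" for i using that not_less_Least unfolding n_def by blast
  \<comment> \<open>Up to \<open>R n\<close> only the moves before the \<open>n\<close>-th occur, so
    the cops still stand where \<open>\<sigma>\<close> puts them when the robber jumps.\<close>
  then have "legal_history G s \<sigma> (map R [0..<Suc n])"
    by (simp add: legal_history_map_upt del: upt_Suc)
  then have same: "cops_at ?\<tau> R (Suc n) = cops_at \<sigma> R (Suc n)"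
    unfolding cops_at_def by (rule follow_or_pounce_legal)
  have "set (cops_at \<sigma> R (Suc n)) \<subseteq> verts G"
    unfolding cops_at_def using verts by (intro cops_strategy_verts[OF \<sigma>]) auto
  moreover have "robber_move (dist_power G s) 1 (cops_at \<sigma> R (Suc n)) (R n) (R (Suc n))"
    using play by (metis same robber_play_def)
  ultimately obtain C' where "cops_move G s (cops_at \<sigma> R (Suc n)) C'" "R (Suc n) \<in> set C'"
    using jump by (rule cops_catch_after_jump)
  then have "R (Suc n) \<in> set (pounce G s (cops_at ?\<tau> R (Suc n)) (R (Suc n)))"
    unfolding same by (rule pounce_catches)
  moreover have "\<not> legal_history G s \<sigma> (map R [0..<Suc (Suc n)])"
    using jump by (auto simp: legal_history_map_upt simp del: upt_Suc)
  then have "cops_at ?\<tau> R (Suc (Suc n)) = pounce G s (cops_at ?\<tau> R (Suc n)) (R (Suc n))"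
    using follow_or_pounce_snoc[of G s \<sigma> "map R [0..<Suc n]" "R (Suc n)"]
    by (simp add: cops_at_def)
  \<comment> \<open>The capture is by the cops' answer to \<open>R (Suc n)\<close>: the second
    disjunct of \<open>captures\<close>, at index \<open>Suc n\<close>.\<close>
  ultimately show ?thesis unfolding captures_def by metis
qed

lemma cops_win_dist_power_iff: "cops_win (dist_power G s) 1 1 k \<longleftrightarrow> cops_win G s s k"
proof
  assume "cops_win (dist_power G s) 1 1 k"
  \<comment> \<open>The same \<open>\<sigma>\<close> wins in \<open>G\<close>: its plays there are
    among those in the power, and \<open>captures\<close> does not refer to a digraph.\<close>
  moreover have "robber_play (dist_power G s) 1 \<sigma> R" if "robber_play G s \<sigma> R" for \<sigma> R
    using that by (simp add: robber_play_def robber_move_dist_powerI[unfolded One_nat_def])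
  ultimately show "cops_win G s s k"
    unfolding cops_win_def cops_strategy_dist_power by blast
next
  assume "cops_win G s s k"
  then show "cops_win (dist_power G s) 1 1 k"
    unfolding cops_win_def cops_strategy_dist_power
    using cops_strategy_follow_or_pounce captures_follow_or_pounce by meson
qed

end

theorem proposition3p1:
  fixes G :: "('a, 'b) pre_digraph" and s :: nat
  assumes "fin_digraph G"
    and "s \<ge> 1"
  shows "speed_cop_number G s s = cop_number (dist_power G s)"
proof -
  interpret fin_digraph G by fact
  show ?thesis
    unfolding cop_number_def speed_cop_number_def cops_win_dist_power_iff ..
qed

end
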